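(* Let $\phi:(0,\infty)\to\mathbb{R}$ be continuous and increasing, not necessarily in the strict sense, and suppose that one of the following holds: (A1) $\liminf_{t\to\infty} t^2\phi(t)>\frac14$; (A2) $\int_a^\infty \phi(t)\,dt=+\infty$ for some $a>0$; (A3) $\liminf_{t\to\infty}\, t\int_t^\infty\phi(s)\,ds>\frac14$. Let $u$ be an oscillatory solution of $u''+\phi(t)u=0$, $t>0$, let $0<\zeta_1<\zeta_2<\cdots$ be all the zeros of $u$ in $(0,\infty)$ arranged in ascending order, and assume that $u(0+)=0$ and $u(t)>0$ for all $0<t<\zeta_1$. Put $$(Uf)(x)=\int_0^\infty f(t)\,u(xt)\,dt\qquad(x>0).$$ If $f$ is a nonnegative and sectionally continuous function on $(0,\infty)$ that is strictly decreasing on its support and satisfies (P1) $\int_0^1 f(t)\,u(t)\,dt<\infty$, (P2) $\lim_{k\to\infty}\int_{\zeta_k}^{\zeta_{k+1}} f(t/x)\,|u(t)|\,dt=0$ for each $x>0$, then $(Uf)(x)$ exists for each $x>0$, and $(Uf)(x)>0$.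
   Context: A function is oscillatory on an interval if it changes sign infinitely often there. Under the stated assumptions on $\phi$ and $u$, the zeros of $u$ in $(0,\infty)$ are all simple and can be enumerated in ascending order. "Sectionally continuous" means piecewise continuous. Integrals over $(0,\infty)$ are improper integrals, and "exists" means that the integral converges.
   Formalization: For x>1, convergence at 0 of the integral of f(t)u(xt) is assumed (false otherwise: φ=1-t^{-4}, f=e^{1/t}-1, u~te^{-1/t} at 0, x=2); the support of f is assumed to be a nonempty initial segment of (0,∞) (f=0, or f vanishing near 0, breaks positivity). *)

theory Defs
  imports "HOL-Analysis.Analysis"
begin

definition solves_on_pos :: "(real \<Rightarrow> real) \<Rightarrow> (real \<Rightarrow> real) \<Rightarrow> bool" where
  "solves_on_pos \<phi> u \<longleftrightarrow>
     (\<exists>u'. \<forall>t>0. (u has_real_derivative u' t) (at t) \<and>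
                 (u' has_real_derivative - (\<phi> t * u t)) (at t))"

(* Infinitely many sign changes: arbitrarily long finite increasing sequences of
   points along which u alternates in sign. *)
definition oscillatory_on :: "real set \<Rightarrow> (real \<Rightarrow> real) \<Rightarrow> bool" where
  "oscillatory_on S u \<longleftrightarrow>
     (\<forall>n::nat. \<exists>p::nat \<Rightarrow> real. (\<forall>i\<le>n. p i \<in> S) \<and>
        (\<forall>i<n. p i < p (Suc i) \<and> u (p i) * u (p (Suc i)) < 0))"

definition cond_A1 :: "(real \<Rightarrow> real) \<Rightarrow> bool" where
  "cond_A1 \<phi> \<longleftrightarrow> Liminf at_top (\<lambda>t. ereal (t\<^sup>2 * \<phi> t)) > ereal (1/4)"

definition cond_A2 :: "(real \<Rightarrow> real) \<Rightarrow> bool" where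
  "cond_A2 \<phi> \<longleftrightarrow> (\<exists>a>0. filterlim (\<lambda>T. integral {a..T} \<phi>) at_top at_top)"

(* J t is the improper integral of \<phi> over (t, \<infinity>). It is allowed to be infinite, which
   makes the condition no more restrictive than if convergence were demanded. *)
definition cond_A3 :: "(real \<Rightarrow> real) \<Rightarrow> bool" where
  "cond_A3 \<phi> \<longleftrightarrow>
     (\<exists>J::real \<Rightarrow> ereal.
        (\<forall>t>0. ((\<lambda>T. ereal (integral {t..T} \<phi>)) \<longlongrightarrow> J t) at_top) \<and>
        Liminf at_top (\<lambda>t. ereal t * J t) > ereal (1/4))"

definition sectionally_continuous_on_pos :: "(real \<Rightarrow> real) \<Rightarrow> bool" where
  "sectionally_continuous_on_pos f \<longleftrightarrow>
     (\<forall>a b. 0 < a \<and> a < b \<longrightarrow> finite {t \<in> {a..b}. \<not> isCont f t}) \<and>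
     (\<forall>t>0. (\<exists>l. (f \<longlongrightarrow> l) (at_left t)) \<and> (\<exists>r. (f \<longlongrightarrow> r) (at_right t)))"

definition support_pos :: "(real \<Rightarrow> real) \<Rightarrow> real set" where
  "support_pos f = {t. 0 < t \<and> f t \<noteq> 0}"

definition improper_at_0_converges :: "(real \<Rightarrow> real) \<Rightarrow> bool" where
  "improper_at_0_converges g \<longleftrightarrow>
     (\<forall>\<epsilon>. 0 < \<epsilon> \<and> \<epsilon> \<le> 1 \<longrightarrow> g integrable_on {\<epsilon>..1}) \<and>
     (\<exists>I. ((\<lambda>\<epsilon>. integral {\<epsilon>..1} g) \<longlongrightarrow> I) (at_right 0))"

(* Improper integral over (0, \<infinity>): the two endpoints tend to 0 and to \<infinity> independently,
   and absolute convergence is not required. *)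
definition has_improper_integral :: "(real \<Rightarrow> real) \<Rightarrow> real \<Rightarrow> bool" where
  "has_improper_integral g I \<longleftrightarrow>
     (\<forall>a b. 0 < a \<and> a \<le> b \<longrightarrow> g integrable_on {a..b}) \<and>
     ((\<lambda>(a, b). integral {a..b} g) \<longlongrightarrow> I) (at_right 0 \<times>\<^sub>F at_top)"

definition improper_integral :: "(real \<Rightarrow> real) \<Rightarrow> real" where
  "improper_integral g = (THE I. has_improper_integral g I)"

definition U_exists :: "(real \<Rightarrow> real) \<Rightarrow> (real \<Rightarrow> real) \<Rightarrow> real \<Rightarrow> bool" where
  "U_exists u f x \<longleftrightarrow> (\<exists>I. has_improper_integral (\<lambda>t. f t * u (x * t)) I)"

definition U_transform :: "(real \<Rightarrow> real) \<Rightarrow> (real \<Rightarrow> real) \<Rightarrow> real \<Rightarrow> real" where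
  "U_transform u f x = improper_integral (\<lambda>t. f t * u (x * t))"

end

theory Submission
  imports Defs
begin

text \<open>
  Reflecting \<open>u\<close> at a zero \<open>c\<close> and comparing \<open>\<bar>u (c + s)\<bar>\<close> with \<open>\<bar>u (c - s)\<bar>\<close> by a Sturm argument,
  the monotonicity of \<open>\<phi>\<close> makes each half-wave of \<open>u\<close> fit below the preceding one. Hence the
  areas of the half-waves decrease, and the alternating signs give \<open>(-1) ^ k * \<integral> u \<ge> 0\<close> over
  \<open>[\<zeta> k, T]\<close> for all \<open>T\<close>, where \<open>\<zeta> 0 = 0\<close>. By the second mean value theorem this survives multiplication by
  a nonnegative decreasing weight, so the tail of \<open>\<integral> f u\<close> from \<open>\<zeta> k\<close> on is bounded by the
  \<open>k\<close>-th weighted half-wave, which tends to \<open>0\<close>. For strict positivity, \<open>f\<close> is cut off at a value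
  \<open>f p\<close> with \<open>p < \<zeta> 1\<close>: the bounded part contributes at least \<open>0\<close>, and the remainder lives where
  \<open>u > 0\<close>.
\<close>

section \<open>Sturm comparison\<close>

text \<open>The larger coefficient \<open>q\<close> bends \<open>w\<close> down faster, so the
  quotient \<open>w / v\<close> can only decrease from its limit at \<open>0\<close>. The common
  initial slope has to be nonzero for that limit to be \<open>1\<close>.\<close>

lemma sturm_comparison:
  fixes v w v' w' p q :: "real \<Rightarrow> real"
  assumes v: "\<And>s. 0 \<le> s \<Longrightarrow> s < L \<Longrightarrow> (v has_real_derivative v' s) (at s)"
    and v': "\<And>s. 0 \<le> s \<Longrightarrow> s < L \<Longrightarrow> (v' has_real_derivative - (p s * v s)) (at s)"
    and w: "\<And>s. 0 \<le> s \<Longrightarrow> s < L \<Longrightarrow> (w has_real_derivative w' s) (at s)"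
    and w': "\<And>s. 0 \<le> s \<Longrightarrow> s < L \<Longrightarrow> (w' has_real_derivative - (q s * w s)) (at s)"
    and init: "v 0 = 0" "w 0 = 0" "v' 0 = w' 0" "v' 0 \<noteq> 0"
    and pos: "\<And>s. 0 < s \<Longrightarrow> s < L \<Longrightarrow> 0 < v s \<and> 0 < w s"
    and pq: "\<And>s. 0 < s \<Longrightarrow> s < L \<Longrightarrow> p s \<le> q s"
    and s: "0 < s" "s < L"
  shows "w s \<le> v s"
proof -
  define W where "W = (\<lambda>s. v s * w' s - v' s * w s)"
  have W: "W t \<le> 0" if "0 < t" "t < L" for t
  proof -
    have "W t \<le> W 0"
    proof (rule DERIV_nonpos_imp_nonincreasing[of 0 t W])
      fix x assume x: "0 \<le> x" "x \<le> t"
      with that have xL: "x < L" by simp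
      have "(W has_real_derivative (p x - q x) * (v x * w x)) (at x)"
        unfolding W_def
        by (rule derivative_eq_intros v v' w w' x xL refl)+ (simp add: algebra_simps)
      moreover have "(p x - q x) * (v x * w x) \<le> 0"
      proof (cases "x = 0")
        case False
        then show ?thesis
          using pos[of x] pq[of x] x xL by (intro mult_nonpos_nonneg) auto
      qed (simp add: init)
      ultimately show "\<exists>y. (W has_real_derivative y) (at x) \<and> y \<le> 0" by blast
    qed (use that in simp)
    then show ?thesis by (simp add: W_def init)
  qed
  \<comment> \<open>The Wronskian \<open>W\<close> is the numerator of the derivative of \<open>w / v\<close>, which tends to \<open>1\<close> at \<open>0\<close>.\<close>
  have ratio: "w s / v s \<le> w h / v h" if "0 < h" "h < s" for h
  proof (rule DERIV_nonpos_imp_nonincreasing[of h s "\<lambda>x. w x / v x"])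
    fix x assume "h \<le> x" "x \<le> s"
    then have x: "0 \<le> x" "0 < x" "x < L" using that s by auto
    have "v x > 0" using pos x by blast
    then have "((\<lambda>x. w x / v x) has_real_derivative W x / (v x)\<^sup>2) (at x)"
      unfolding W_def
      by (auto intro!: derivative_eq_intros v w x simp: field_simps power2_eq_square)
    moreover have "W x / (v x)\<^sup>2 \<le> 0" using W x by (simp add: divide_nonpos_nonneg)
    ultimately show "\<exists>y. ((\<lambda>x. w x / v x) has_real_derivative y) (at x) \<and> y \<le> 0" by blast
  qed (use that in simp)
  have lim: "((\<lambda>h. y h / h) \<longlongrightarrow> D) (at_right 0)"
    if "(y has_real_derivative D) (at 0)" "y 0 = 0" for y :: "real \<Rightarrow> real" and D
  proof -
    have "((\<lambda>h. y h / h) \<longlongrightarrow> D) (at 0)"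
      using that by (simp add: DERIV_def)
    then show ?thesis by (rule filterlim_mono) (auto simp: at_le)
  qed
  \<comment> \<open>Both functions vanish at \<open>0\<close>, so dividing each by \<open>h\<close>
    turns \<open>w h / v h\<close> into a quotient of difference quotients, whose limit is
    known.\<close>
  have "((\<lambda>h. (w h / h) / (v h / h)) \<longlongrightarrow> w' 0 / v' 0) (at_right 0)"
    using s init by (intro tendsto_divide lim v w) auto
  moreover have "\<forall>\<^sub>F h in at_right 0. w s / v s \<le> (w h / h) / (v h / h)"
    using eventually_at_right_less[of "0::real"] eventually_at_right_real[OF s(1)]
  proof eventually_elim
    case (elim h)
    then show ?case using ratio[of h] by simp
  qed
  ultimately have "w s / v s \<le> w' 0 / v' 0"
    by (rule tendsto_lowerbound) simp
  then show ?thesis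
    using init pos[OF s] by (simp add: field_simps)
qed

section \<open>Integrals against decreasing weights\<close>

lemma antimono_second_mean_value:
  fixes f g :: "real \<Rightarrow> real"
  assumes "f integrable_on {a..b}" "a \<le> b" "antimono_on {a..b} g"
  obtains c where "c \<in> {a..b}"
    "((\<lambda>x. g x * f x) has_integral (g a * integral {a..c} f + g b * integral {c..b} f)) {a..b}"
proof -
  obtain c where c: "c \<in> {a..b}"
    "((\<lambda>x. - g x * f x) has_integral (- g a * integral {a..c} f + - g b * integral {c..b} f)) {a..b}"
    using second_mean_value_theorem_full[of f a b "\<lambda>x. - g x"] assms
    by (auto simp: monotone_on_def)
  from has_integral_neg[OF c(2)] show thesis
    by (intro that[OF c(1)]) (simp add: algebra_simps)
qed

lemma integrable_antimono_mult:
  fixes f g :: "real \<Rightarrow> real"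
  assumes "f integrable_on {a..b}" "antimono_on {a..b} g"
  shows "(\<lambda>x. g x * f x) integrable_on {a..b}"
proof (cases "a \<le> b")
  case True
  then show ?thesis
    using antimono_second_mean_value[OF assms(1) True assms(2)] by (blast intro: has_integral_integrable)
qed auto

text \<open>The second mean value theorem, followed by splitting at \<open>c\<close>, gives a
  combination of two integrals of \<open>f\<close> starting at \<open>a\<close>, with the
  nonnegative coefficients \<open>g a - g b\<close> and \<open>g b\<close>. Hence only integrals
  from the left end need a sign.\<close>

lemma integral_antimono_mult_nonneg:
  fixes f g :: "real \<Rightarrow> real"
  assumes f: "f integrable_on {a..b}" "a \<le> b" and g: "antimono_on {a..b} g" "0 \<le> g b"
    and partial: "\<And>c. a \<le> c \<Longrightarrow> c \<le> b \<Longrightarrow> 0 \<le> integral {a..c} f"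
  shows "0 \<le> integral {a..b} (\<lambda>x. g x * f x)"
proof -
  obtain c where c: "c \<in> {a..b}"
    "((\<lambda>x. g x * f x) has_integral (g a * integral {a..c} f + g b * integral {c..b} f)) {a..b}"
    using antimono_second_mean_value[OF f g(1)] .
  have split: "integral {c..b} f = integral {a..b} f - integral {a..c} f"
    using Henstock_Kurzweil_Integration.integral_combine[of a c b f] f c(1) by auto
  have "integral {a..b} (\<lambda>x. g x * f x) = (g a - g b) * integral {a..c} f + g b * integral {a..b} f"
    using integral_unique[OF c(2)] by (simp add: split algebra_simps)
  moreover have "g b \<le> g a" using g(1) f(2) by (auto simp: monotone_on_def)
  ultimately show ?thesis
    using c(1) g(2) f(2) partial by simp
qed

section \<open>Cauchy criterion along a filter\<close>

lemma tendsto_if_cauchy: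
  fixes h :: "'a \<Rightarrow> real"
  assumes "F \<noteq> bot"
    and "\<And>e. e > 0 \<Longrightarrow> \<exists>P. eventually P F \<and> (\<forall>x y. P x \<longrightarrow> P y \<longrightarrow> dist (h x) (h y) < e)"
  shows "\<exists>l. (h \<longlongrightarrow> l) F"
proof -
  have "cauchy_filter (filtermap h F)"
    unfolding cauchy_filter_metric_filtermap using assms(2) by blast
  moreover have "complete (UNIV :: real set)"
    by (meson Cauchy_convergent UNIV_I complete_def convergent_def)
  ultimately show ?thesis
    using complete_uniform[where S="UNIV :: real set"] assms(1)
    by (force simp add: filterlim_def filtermap_bot_iff)
qed

lemma cauchy_if_tendsto:
  fixes h :: "'a \<Rightarrow> real"
  assumes "(h \<longlongrightarrow> l) F" "e > 0"
  shows "\<exists>P. eventually P F \<and> (\<forall>x y. P x \<longrightarrow> P y \<longrightarrow> dist (h x) (h y) < e)"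
proof (intro exI conjI allI impI)
  show "\<forall>\<^sub>F x in F. dist (h x) l < e / 2"
    using tendstoD[OF assms(1), of "e / 2"] assms(2) by simp
  show "dist (h x) (h y) < e" if "dist (h x) l < e / 2" "dist (h y) l < e / 2" for x y
    using dist_triangle_half_l[of "h x" l e "h y"] that by (simp add: dist_commute)
qed

section \<open>The solution, its zeros and its signs\<close>

text \<open>Counting the left end as zero number \<open>0\<close> gives half-wave number
  \<open>k\<close> the sign \<open>(-1) ^ k\<close>. Continuity on the closed half-line, together
  with this zero, encodes \<open>u(0+) = 0\<close>. The assumptions are stable under scaling of the
  argument, which later brings in the parameter of the transform.\<close>

locale oscillating_solution =
  fixes \<phi> u u' :: "real \<Rightarrow> real" and Z :: "nat \<Rightarrow> real"
  assumes phi_mono: "mono_on {0<..} \<phi>"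
    and u_cont: "continuous_on {0..} u"
    and u_deriv: "\<And>t. 0 < t \<Longrightarrow> (u has_real_derivative u' t) (at t)"
    and u'_deriv: "\<And>t. 0 < t \<Longrightarrow> (u' has_real_derivative - (\<phi> t * u t)) (at t)"
    and Z_mono: "strict_mono Z" and Z_0: "Z 0 = 0"
    and zeros: "\<And>t. 0 \<le> t \<Longrightarrow> u t = 0 \<longleftrightarrow> t \<in> range Z"
    and u_pos: "\<And>t. 0 < t \<Longrightarrow> t < Z 1 \<Longrightarrow> 0 < u t"
begin

lemma u_chain:
  "(g has_real_derivative d) (at t) \<Longrightarrow> 0 < g t \<Longrightarrow>
    ((\<lambda>s. u (g s)) has_real_derivative u' (g t) * d) (at t)"
  by (rule DERIV_chain2[OF u_deriv])

lemma u'_chain: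
  "(g has_real_derivative d) (at t) \<Longrightarrow> 0 < g t \<Longrightarrow>
    ((\<lambda>s. u' (g s)) has_real_derivative - (\<phi> (g t) * u (g t)) * d) (at t)"
  by (rule DERIV_chain2[OF u'_deriv])

lemma Z_less: "i < j \<Longrightarrow> Z i < Z j" and Z_le: "i \<le> j \<Longrightarrow> Z i \<le> Z j"
  using Z_mono by (simp_all add: strict_mono_less strict_mono_less_eq)

lemma Z_nonneg: "0 \<le> Z k" and Z_Suc_pos: "0 < Z (Suc k)"
  using Z_le[of 0 k] Z_less[of 0 "Suc k"] by (simp_all add: Z_0)

lemma u_Z [simp]: "u (Z k) = 0"
  using zeros[of "Z k"] Z_nonneg by simp

lemma u_nonzero:
  assumes "Z k < t" "t < Z (Suc k)"
  shows "u t \<noteq> 0"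
proof
  assume "u t = 0"
  then obtain j where j: "t = Z j" using zeros[of t] assms Z_nonneg[of k] by auto
  with assms show False
    using Z_mono by (simp add: strict_mono_less)
qed

text \<open>Bounded zeros would increase to a limit \<open>p\<close>, where \<open>u\<close>
  vanishes by continuity. As every zero is listed, \<open>p\<close> is some \<open>Z j\<close>, yet
  \<open>Z (Suc j)\<close> already exceeds it.\<close>

lemma Z_unbounded: "\<exists>k. T < Z k"
proof (rule ccontr)
  assume "\<not> ?thesis"
  then have bound: "Z k \<le> T" for k by (simp add: not_less)
  obtain p where p: "Z \<longlonglongrightarrow> p" and p_upper: "\<forall>i. Z i \<le> p"
    using incseq_convergent[of Z T] Z_mono bound strict_mono_mono by blast
  have "p > 0" using Z_Suc_pos[of 0] p_upper by (meson less_le_trans)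
  then have "(\<lambda>k. u (Z k)) \<longlonglongrightarrow> u p"
    by (intro isCont_tendsto_compose[OF _ p] DERIV_isCont[OF u_deriv])
  then have "u p = 0" by (simp add: LIMSEQ_const_iff)
  then obtain j where "p = Z j" using zeros[of p] \<open>p > 0\<close> by auto
  then show False using p_upper Z_less[of j "Suc j"] by (meson lessI not_less)
qed

text \<open>Uniqueness for the initial value problem: a double zero at \<open>c\<close> would force
  \<open>u\<close> to vanish also at the midpoint \<open>a\<close> of the half-wave before it.
  Monotonicity bounds \<phi> between \<open>a\<close> and \<open>c\<close> by its two end
  values.\<close>

lemma u'_Z_nonzero: "u' (Z (Suc k)) \<noteq> 0"
proof
  define c where "c = Z (Suc k)"
  define a where "a = (Z k + c) / 2"
  define C where "C = 1 + \<bar>\<phi> a\<bar> + \<bar>\<phi> c\<bar>"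
  assume "u' (Z (Suc k)) = 0"
  then have c0: "u' c = 0" "u c = 0" by (simp_all add: c_def)
  have a: "Z k < a" "a < c" "0 < a" 
    using Z_less[of k "Suc k"] Z_nonneg[of k] by (simp_all add: a_def c_def)
  \<comment> \<open>Gronwall: \<open>C\<close> is chosen so that this weighted energy increases on \<open>[a, c]\<close>.\<close>
  define E where "E = (\<lambda>t. ((u t)\<^sup>2 + (u' t)\<^sup>2) * exp (C * t))"
  have "E a \<le> E c"
  proof (rule DERIV_nonneg_imp_nondecreasing[of a c E])
    fix t assume t: "a \<le> t" "t \<le> c"
    then have t0: "0 < t" using a by simp
    have "\<phi> a \<le> \<phi> t" "\<phi> t \<le> \<phi> c"
      using phi_mono t t0 a by (auto simp: monotone_on_def)
    then have "\<bar>1 - \<phi> t\<bar> \<le> C" by (simp add: C_def)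
    have "\<bar>2 * u t * u' t\<bar> \<le> (u t)\<^sup>2 + (u' t)\<^sup>2"
      using sum_squares_bound[of "\<bar>u t\<bar>" "\<bar>u' t\<bar>"] by (simp add: abs_mult)
    then have "\<bar>(1 - \<phi> t) * (2 * u t * u' t)\<bar> \<le> C * ((u t)\<^sup>2 + (u' t)\<^sup>2)"
      unfolding abs_mult[of "1 - \<phi> t"] using \<open>\<bar>1 - \<phi> t\<bar> \<le> C\<close> by (intro mult_mono) auto
    then have "0 \<le> ((1 - \<phi> t) * (2 * u t * u' t) + C * ((u t)\<^sup>2 + (u' t)\<^sup>2)) * exp (C * t)"
      by simp
    moreover have "(E has_real_derivative
        ((1 - \<phi> t) * (2 * u t * u' t) + C * ((u t)\<^sup>2 + (u' t)\<^sup>2)) * exp (C * t)) (at t)"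
      unfolding E_def
      by (rule derivative_eq_intros u_deriv u'_deriv t0 refl)+
        (simp add: algebra_simps power2_eq_square)
    ultimately show "\<exists>y. (E has_real_derivative y) (at t) \<and> 0 \<le> y" by blast
  qed (use a in simp)
  then have "((u a)\<^sup>2 + (u' a)\<^sup>2) * exp (C * a) \<le> 0" by (simp add: E_def c0)
  then have "(u a)\<^sup>2 + (u' a)\<^sup>2 \<le> 0" by (simp add: mult_le_0_iff)
  then have "u a = 0" by (simp add: sum_power2_le_zero_iff)
  then show False using u_nonzero[of k a] a by (simp add: c_def)
qed

text \<open>A simple zero is a sign change, and between consecutive zeros the sign persists by the
  intermediate value theorem.\<close>

lemma sign_u: "Z k < t \<Longrightarrow> t < Z (Suc k) \<Longrightarrow> 0 < (-1) ^ k * u t"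
proof (induction k arbitrary: t)
  case 0
  then show ?case using u_pos by (simp add: Z_0)
next
  case (Suc k)
  define c where "c = Z (Suc k)"
  define y where "y = (\<lambda>t. (-1) ^ k * u t)"
  have c: "0 < c" "Z k < c" "c < Z (Suc (Suc k))"
    using Z_Suc_pos[of k] Z_less by (simp_all add: c_def)
  have y: "(y has_real_derivative (-1) ^ k * u' c) (at c)" "y c = 0"
    unfolding y_def using u_deriv[OF c(1)] by (auto intro: DERIV_cmult simp: c_def)
  \<comment> \<open>A positive slope at \<open>c\<close> would make \<open>y\<close> negative just
    to the left of \<open>c\<close>, against the induction hypothesis.\<close>
  have "\<not> 0 < (-1) ^ k * u' c"
  proof
    assume "0 < (-1) ^ k * u' c"
    from DERIV_pos_inc_left[OF y(1) this]
    obtain d where d: "d > 0" "\<And>h. 0 < h \<Longrightarrow> h < d \<Longrightarrow> y (c - h) < 0"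
      using y(2) by auto
    define h where "h = min (d / 2) ((c - Z k) / 2)"
    have "h \<le> (c - Z k) / 2" "h \<le> d / 2" "0 < h"
      using d(1) c(2) unfolding h_def by (simp_all add: min_def)
    then have "c - h < Z (Suc k)" "h < d" using d(1) by (simp_all add: c_def)
    moreover have "Z k < c - h"
      using \<open>h \<le> (c - Z k) / 2\<close> c(2) by (simp add: field_simps)
    moreover note \<open>0 < h\<close>
    ultimately show False
      using d(2)[of h] Suc.IH[of "c - h"] by (simp add: y_def)
  qed
  with u'_Z_nonzero[of k] have "(-1) ^ k * u' c < 0" by (simp add: c_def not_less le_less)
  from DERIV_neg_dec_right[OF y(1) this]
  obtain d where d: "d > 0" "\<And>h. 0 < h \<Longrightarrow> h < d \<Longrightarrow> y (c + h) < 0"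
    using y(2) by auto
  \<comment> \<open>The halvings place \<open>c + h\<close> strictly between \<open>c\<close> and
    \<open>t\<close>, at a point where \<open>y\<close> is already negative; a nonnegative
    \<open>y t\<close> would then produce a zero inside the half-wave.\<close>
  define h where "h = min (d / 2) ((t - c) / 2)"
  have t: "c < t" using Suc.prems by (simp add: c_def)
  have "h \<le> (t - c) / 2" "h \<le> d / 2" "0 < h"
    using d(1) t unfolding h_def by (simp_all add: min_def)
  moreover from this have "c + h < t" "h < d" using d(1) t by (simp_all add: field_simps)
  ultimately have h: "c + h < t" "0 < h" "h < d" by simp_all
  have "y t < 0"
  proof (rule ccontr)
    assume "\<not> y t < 0"
    moreover have "continuous_on {c + h..t} y"
      unfolding y_def using c h by (intro continuous_intros continuous_on_subset[OF u_cont]) auto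
    ultimately obtain z where z: "c + h \<le> z" "z \<le> t" "y z = 0"
      using IVT'[of y "c + h" 0 t] d(2)[OF h(2,3)] h(1) by (auto simp: not_less)
    then show False
      using u_nonzero[of "Suc k" z] h Suc.prems by (simp add: y_def c_def)
  qed
  then show ?case by (simp add: y_def)
qed

lemma sign_u_abs: "Z k \<le> t \<Longrightarrow> t \<le> Z (Suc k) \<Longrightarrow> (-1) ^ k * u t = \<bar>u t\<bar>"
proof -
  assume t: "Z k \<le> t" "t \<le> Z (Suc k)"
  show ?thesis
  proof (cases "t = Z k \<or> t = Z (Suc k)")
    case False
    then have "0 < (-1) ^ k * u t" using sign_u t by simp
    moreover have "\<bar>(-1) ^ k * u t\<bar> = \<bar>u t\<bar>" by (simp add: abs_mult)
    ultimately show ?thesis by linarith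
  qed auto
qed

lemma u_integrable: "0 \<le> a \<Longrightarrow> u integrable_on {a..b}"
  by (intro integrable_continuous_real continuous_on_subset[OF u_cont]) auto

section \<open>Reflection at a zero: half-waves shrink\<close>

text \<open>Up to sign, \<open>u (c - s)\<close> and \<open>u (c + s)\<close> solve equations in
  \<open>s\<close> with coefficients \<open>\<phi> (c - s) \<le> \<phi> (c + s)\<close>. The signs
  \<open>\<sigma>\<close> and \<open>- \<sigma>\<close> make both positive and give them the same
  initial slope, so the Sturm comparison applies up to the end of the shorter half-wave.\<close>

lemma reflected_le:
  fixes k :: nat
  defines "c \<equiv> Z (Suc k)"
  assumes s: "0 < s" "s < Z (Suc (Suc k)) - c" "s < c - Z k"
  shows "\<bar>u (c + s)\<bar> \<le> \<bar>u (c - s)\<bar>"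
proof -
  define L where "L = min (Z (Suc (Suc k)) - c) (c - Z k)"
  define \<sigma> :: real where "\<sigma> = (-1) ^ k"
  have c: "0 < c" using Z_Suc_pos by (simp add: c_def)
  have Ls: "t < c" "t < c - Z k" "c + t < Z (Suc (Suc k))" if "t < L" for t
    using that Z_nonneg[of k] by (auto simp: L_def)
  have "- \<sigma> * u (c + s) \<le> \<sigma> * u (c - s)"
  proof (rule sturm_comparison[where L=L and s=s
        and v="\<lambda>s. \<sigma> * u (c - s)" and w="\<lambda>s. - \<sigma> * u (c + s)" and v'="\<lambda>s. - \<sigma> * u' (c - s)" and w'="\<lambda>s. - \<sigma> * u' (c + s)"
        and p="\<lambda>s. \<phi> (c - s)" and q="\<lambda>s. \<phi> (c + s)"])
    fix t assume t: "0 \<le> t" "t < L"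
    have pos: "0 < c - t" "0 < c + t" using Ls[OF t(2)] t c by auto
    show "((\<lambda>s. \<sigma> * u (c - s)) has_real_derivative - \<sigma> * u' (c - t)) (at t)"
      by (auto intro!: derivative_eq_intros u_chain u'_chain pos)
    show "((\<lambda>s. - \<sigma> * u' (c - s)) has_real_derivative - (\<phi> (c - t) * (\<sigma> * u (c - t)))) (at t)"
      by (auto intro!: derivative_eq_intros u_chain u'_chain pos)
    show "((\<lambda>s. - \<sigma> * u (c + s)) has_real_derivative - \<sigma> * u' (c + t)) (at t)"
      by (auto intro!: derivative_eq_intros u_chain u'_chain pos)
    show "((\<lambda>s. - \<sigma> * u' (c + s)) has_real_derivative - (\<phi> (c + t) * (- \<sigma> * u (c + t)))) (at t)"
      by (auto intro!: derivative_eq_intros u_chain u'_chain pos)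
  next
    fix t assume t: "0 < t" "t < L"
    show "0 < \<sigma> * u (c - t) \<and> 0 < - \<sigma> * u (c + t)"
      using sign_u[of k "c - t"] sign_u[of "Suc k" "c + t"] Ls[OF t(2)] t(1)
      by (simp add: \<sigma>_def c_def)
    show "\<phi> (c - t) \<le> \<phi> (c + t)"
      using phi_mono Ls[OF t(2)] t(1) c by (auto simp: monotone_on_def)
  qed (use s u'_Z_nonzero[of k] in \<open>auto simp: L_def \<sigma>_def c_def\<close>)
  then show ?thesis
    using sign_u_abs[of k "c - s"] sign_u_abs[of "Suc k" "c + s"] s by (simp add: \<sigma>_def c_def)
qed

text \<open>If the later half-wave were longer, the comparison would extend by continuity to
  \<open>s = L\<close>, where the reflected earlier one vanishes. This would put a zero inside the
  later one.\<close>

lemma gap_antimono: "Z (Suc (Suc k)) - Z (Suc k) \<le> Z (Suc k) - Z k"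
proof (rule ccontr)
  define c where "c = Z (Suc k)"
  define L where "L = c - Z k"
  assume "\<not> ?thesis"
  then have *: "L < Z (Suc (Suc k)) - c" by (simp add: L_def c_def)
  have L: "0 < L" using Z_less[of k "Suc k"] by (simp add: L_def c_def)
  have "\<bar>u (c - L)\<bar> - \<bar>u (c + L)\<bar> \<ge> 0"
  proof (rule continuous_ge_on_closure[where S="{0<..<L}" and f="\<lambda>s. \<bar>u (c - s)\<bar> - \<bar>u (c + s)\<bar>"])
    have "L \<le> c" "0 < c" using Z_nonneg Z_Suc_pos by (simp_all add: L_def c_def)
    then show "continuous_on (closure {0<..<L}) (\<lambda>s. \<bar>u (c - s)\<bar> - \<bar>u (c + s)\<bar>)"
      using L by (auto intro!: continuous_intros continuous_on_compose2[OF u_cont])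
    show "0 \<le> \<bar>u (c - s)\<bar> - \<bar>u (c + s)\<bar>" if "s \<in> {0<..<L}" for s
      using reflected_le[of s k] that * by (simp add: c_def L_def)
  qed (use L in auto)
  then have "u (c + L) = 0" by (simp add: L_def)
  then show False using u_nonzero[of "Suc k" "c + L"] L * by (simp add: c_def)
qed

lemma area_antimono:
  "integral {Z (Suc k)..Z (Suc (Suc k))} (\<lambda>t. \<bar>u t\<bar>) \<le> integral {Z k..Z (Suc k)} (\<lambda>t. \<bar>u t\<bar>)"
proof -
  define c where "c = Z (Suc k)"
  define l where "l = Z (Suc (Suc k)) - c"
  have l: "0 < l" "l \<le> c - Z k" "l \<le> c"
    using Z_less[of "Suc k" "Suc (Suc k)"] gap_antimono[of k] Z_nonneg[of k]
    by (simp_all add: l_def c_def)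
  have int: "(\<lambda>t. \<bar>u t\<bar>) integrable_on {a..b}" if "0 \<le> a" for a b
    using that by (intro integrable_continuous_real continuous_intros continuous_on_subset[OF u_cont]) auto
  have "integral {c..c + l} (\<lambda>t. \<bar>u t\<bar>) = integral {0..l} (\<lambda>s. \<bar>u (c + s)\<bar>)"
    using integral_shift_Icc_real[of 0 l "\<lambda>t. \<bar>u t\<bar>" c] by (simp add: o_def add.commute)
  also have "\<dots> \<le> integral {0..l} (\<lambda>s. \<bar>u (c - s)\<bar>)"
  proof (rule integral_le)
    show "(\<lambda>s. \<bar>u (c + s)\<bar>) integrable_on {0..l}" "(\<lambda>s. \<bar>u (c - s)\<bar>) integrable_on {0..l}"
      using l by (auto intro!: integrable_continuous_real continuous_intros continuous_on_compose2[OF u_cont])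
    fix s assume "s \<in> {0..l}"
    \<comment> \<open>The comparison covers only the open interval; at both of its ends the
      left-hand side is \<open>0\<close>.\<close>
    then consider "s = 0" | "s = l" | "0 < s" "s < l" by fastforce
    then show "\<bar>u (c + s)\<bar> \<le> \<bar>u (c - s)\<bar>"
    proof cases
      case 3
      then show ?thesis using reflected_le[of s k] l by (simp add: c_def l_def)
    qed (simp_all add: l_def)
  qed
  also have "\<dots> = integral {-l..0} (\<lambda>s. \<bar>u (c + s)\<bar>)"
    using Henstock_Kurzweil_Integration.integral_reflect_real
      [where a="-l" and b=0 and f="\<lambda>s. \<bar>u (c + s)\<bar>"]
    by (simp del: Henstock_Kurzweil_Integration.integral_reflect_real)
  also have "\<dots> = integral {c - l..c} (\<lambda>t. \<bar>u t\<bar>)"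
    using integral_shift_Icc_real[of "-l" 0 "\<lambda>t. \<bar>u t\<bar>" c] by (simp add: o_def add.commute)
  also have "\<dots> \<le> integral {Z k..c} (\<lambda>t. \<bar>u t\<bar>)"
    using l Z_nonneg[of k] by (intro integral_subset_le int) auto
  finally show ?thesis by (simp add: l_def c_def)
qed

section \<open>Integrals of \<open>u\<close> starting at a zero\<close>

lemma integral_sign_u:
  assumes "Z k \<le> T" "T \<le> Z (Suc k)"
  shows "(-1) ^ k * integral {Z k..T} u = integral {Z k..T} (\<lambda>t. \<bar>u t\<bar>)"
proof -
  have "(-1) ^ k * integral {Z k..T} u = integral {Z k..T} (\<lambda>t. (-1) ^ k * u t)" by simp
  also have "\<dots> = integral {Z k..T} (\<lambda>t. \<bar>u t\<bar>)"
    using assms by (intro Henstock_Kurzweil_Integration.integral_cong sign_u_abs) auto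
  finally show ?thesis .
qed

text \<open>As for Leibniz series, such an integral is the first area minus a quantity of the same
  kind that starts one zero later. The upper bound is carried along because, with
  \<open>area_antimono\<close>, it keeps this difference nonnegative. The number \<open>n\<close>
  bounds how many half-waves are met before \<open>T\<close>.\<close>

lemma partial_integral_bounds_aux:
  "Z k \<le> T \<Longrightarrow> T \<le> Z (k + n) \<Longrightarrow> 0 \<le> (-1) ^ k * integral {Z k..T} u \<and>
     (-1) ^ k * integral {Z k..T} u \<le> integral {Z k..Z (Suc k)} (\<lambda>t. \<bar>u t\<bar>)"
proof (induction n arbitrary: k)
  case 0
  have "0 \<le> integral {Z k..Z (Suc k)} (\<lambda>t. \<bar>u t\<bar>)"
    by (intro Henstock_Kurzweil_Integration.integral_nonneg integrable_continuous_real
        continuous_intros continuous_on_subset[OF u_cont]) (use Z_nonneg[of k] in auto)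
  with 0 show ?case by simp
next
  case (Suc n)
  have int: "(\<lambda>t. \<bar>u t\<bar>) integrable_on {Z k..b}" for b
    using Z_nonneg[of k]
    by (intro integrable_continuous_real continuous_intros continuous_on_subset[OF u_cont]) auto
  show ?case
  proof (cases "T \<le> Z (Suc k)")
    case True
    show ?thesis
      unfolding integral_sign_u[OF Suc.prems(1) True]
      using True by (auto intro!: Henstock_Kurzweil_Integration.integral_nonneg integral_subset_le int)
  next
    case False
    have "integral {Z k..T} u = integral {Z k..Z (Suc k)} u + integral {Z (Suc k)..T} u"
      using False Z_less[of k "Suc k"] Z_nonneg[of k]
      by (intro Henstock_Kurzweil_Integration.integral_combine[symmetric] u_integrable) auto
    then have "(-1) ^ k * integral {Z k..T} u =
        integral {Z k..Z (Suc k)} (\<lambda>t. \<bar>u t\<bar>) - (-1) ^ Suc k * integral {Z (Suc k)..T} u"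
      using integral_sign_u[of k "Z (Suc k)"] Z_less[of k "Suc k"] by (simp add: distrib_left)
    moreover have "0 \<le> (-1) ^ Suc k * integral {Z (Suc k)..T} u \<and>
        (-1) ^ Suc k * integral {Z (Suc k)..T} u \<le> integral {Z (Suc k)..Z (Suc (Suc k))} (\<lambda>t. \<bar>u t\<bar>)"
      using False Suc.prems by (intro Suc.IH) auto
    ultimately show ?thesis using area_antimono[of k] by linarith
  qed
qed

lemma sign_partial_integral_nonneg:
  assumes "Z k \<le> T"
  shows "0 \<le> (-1) ^ k * integral {Z k..T} u"
proof -
  obtain m where "T < Z m" using Z_unbounded by blast
  then have "T \<le> Z (k + m)" using Z_le[of m "k + m"] by simp
  with assms partial_integral_bounds_aux show ?thesis by blast
qed

text \<open>For \<open>k = 0\<close> the weight must decrease on an interval containing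
  \<open>0\<close>, so it must be bounded near \<open>0\<close>. This is the reason for the cut-off
  weight in the positivity proof.\<close>

lemma sign_weighted_integral_nonneg:
  assumes "Z k \<le> T" "antimono_on {Z k..T} g" "0 \<le> g T"
  shows "0 \<le> (-1) ^ k * integral {Z k..T} (\<lambda>t. g t * u t)"
proof -
  have "(\<lambda>t. (-1) ^ k * u t) integrable_on {Z k..T}"
    by (intro integrable_on_mult_right u_integrable Z_nonneg)
  then have "0 \<le> integral {Z k..T} (\<lambda>t. g t * ((-1) ^ k * u t))"
    by (rule integral_antimono_mult_nonneg[OF _ assms]) (simp add: sign_partial_integral_nonneg)
  also have "(\<lambda>t. g t * ((-1) ^ k * u t)) = (\<lambda>t. (-1) ^ k * (g t * u t))" by (auto simp: fun_eq_iff)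
  finally show ?thesis by simp
qed


section \<open>Weighted tails\<close>

lemma weighted_integrable:
  assumes "antimono_on {0<..} f" "0 < a"
  shows "(\<lambda>t. f t * u t) integrable_on {a..b}"
  using assms
  by (intro integrable_antimono_mult u_integrable monotone_on_subset[OF assms(1)]) auto

text \<open>After the first half-wave the remaining integral has the opposite sign, so it can only
  reduce the first weighted area without reversing the total sign. Taking \<open>0 < k\<close> keeps
  away from \<open>0\<close>, where \<open>f\<close> may be unbounded.\<close>

lemma tail_bound:
  assumes f: "antimono_on {0<..} f" "\<And>t. 0 < t \<Longrightarrow> 0 \<le> f t" and k: "0 < k" and T: "Z k \<le> T"
  shows "\<bar>integral {Z k..T} (\<lambda>t. f t * u t)\<bar> \<le> integral {Z k..Z (Suc k)} (\<lambda>t. f t * \<bar>u t\<bar>)"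
proof -
  have nonneg: "0 \<le> (-1) ^ j * integral {Z j..T} (\<lambda>t. f t * u t)" if "k \<le> j" "Z j \<le> T" for j
    using that k Z_less[of 0 j] Z_0 f(2)[of T]
    by (intro sign_weighted_integral_nonneg monotone_on_subset[OF f(1)]) auto
  have pos: "0 < Z k" using Z_less[of 0 k] k by (simp add: Z_0)
  have int: "(\<lambda>t. f t * \<bar>u t\<bar>) integrable_on {Z k..b}" for b
    using pos
    by (intro integrable_antimono_mult integrable_continuous_real continuous_intros
        continuous_on_subset[OF u_cont] monotone_on_subset[OF f(1)]) auto
  have first: "(-1) ^ k * integral {Z k..b} (\<lambda>t. f t * u t) = integral {Z k..b} (\<lambda>t. f t * \<bar>u t\<bar>)"
    if "b \<le> Z (Suc k)" for b
  proof -
    have "(-1) ^ k * integral {Z k..b} (\<lambda>t. f t * u t) = integral {Z k..b} (\<lambda>t. (-1) ^ k * (f t * u t))"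
      by simp
    also have "\<dots> = integral {Z k..b} (\<lambda>t. f t * \<bar>u t\<bar>)"
      using that by (intro Henstock_Kurzweil_Integration.integral_cong)
        (auto simp flip: sign_u_abs[of k])
    finally show ?thesis .
  qed
  have "(-1) ^ k * integral {Z k..T} (\<lambda>t. f t * u t) \<le> integral {Z k..Z (Suc k)} (\<lambda>t. f t * \<bar>u t\<bar>)"
  proof (cases "T \<le> Z (Suc k)")
    case True
    show ?thesis
      unfolding first[OF True] using True pos f(2) by (intro integral_subset_le int) auto
  next
    case False
    have "integral {Z k..T} (\<lambda>t. f t * u t) = integral {Z k..Z (Suc k)} (\<lambda>t. f t * u t)
        + integral {Z (Suc k)..T} (\<lambda>t. f t * u t)"
      using False Z_less[of k "Suc k"] pos
      by (intro Henstock_Kurzweil_Integration.integral_combine[symmetric] weighted_integrable f(1)) auto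
    then show ?thesis
      using nonneg[of "Suc k"] first[of "Z (Suc k)"] False by (simp add: distrib_left)
  qed
  moreover have "\<bar>integral {Z k..T} (\<lambda>t. f t * u t)\<bar> = \<bar>(-1) ^ k * integral {Z k..T} (\<lambda>t. f t * u t)\<bar>"
    by (simp add: abs_mult)
  ultimately show ?thesis using nonneg[of k] T by simp
qed

section \<open>Convergence, positivity and behaviour near \<open>0\<close>\<close>

text \<open>The two ends are separated at \<open>1\<close>. Convergence at \<open>0\<close> is
  given; at infinity \<open>tail_bound\<close> supplies the Cauchy criterion, and a limit along the
  product filter results from adding the two.\<close>

lemma has_improper_integral_exists:
  assumes f: "antimono_on {0<..} f" "\<And>t. 0 < t \<Longrightarrow> 0 \<le> f t"
    and at_0: "((\<lambda>\<epsilon>. integral {\<epsilon>..1} (\<lambda>t. f t * u t)) \<longlongrightarrow> I) (at_right 0)"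
    and areas: "(\<lambda>k. integral {Z k..Z (Suc k)} (\<lambda>t. f t * \<bar>u t\<bar>)) \<longlonglongrightarrow> 0"
  shows "\<exists>J. has_improper_integral (\<lambda>t. f t * u t) J"
proof -
  let ?h = "\<lambda>t. f t * u t"
  have "\<exists>J. ((\<lambda>b. integral {1..b} ?h) \<longlongrightarrow> J) at_top"
  proof (rule tendsto_if_cauchy)
    fix e :: real assume "e > 0"
    obtain m where m: "1 < Z m" using Z_unbounded by blast
    have "\<forall>\<^sub>F k in sequentially. \<bar>integral {Z k..Z (Suc k)} (\<lambda>t. f t * \<bar>u t\<bar>)\<bar> < e / 2"
      using tendstoD[OF areas, of "e / 2"] \<open>e > 0\<close> by simp
    \<comment> \<open>The bound \<open>Suc m\<close> yields both \<open>1 < Z k\<close> and the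
      \<open>0 < k\<close> required by \<open>tail_bound\<close>.\<close>
    moreover have "\<forall>\<^sub>F k in sequentially. Suc m \<le> k" by (rule eventually_ge_at_top)
    ultimately have "\<forall>\<^sub>F k in sequentially. Suc m \<le> k \<and>
        \<bar>integral {Z k..Z (Suc k)} (\<lambda>t. f t * \<bar>u t\<bar>)\<bar> < e / 2" by eventually_elim simp
    then obtain k where k: "Suc m \<le> k" "\<bar>integral {Z k..Z (Suc k)} (\<lambda>t. f t * \<bar>u t\<bar>)\<bar> < e / 2"
      using eventually_happens'[OF sequentially_bot] by blast
    have Zk: "1 < Z k" using m Z_le[of m k] k by simp
    have "\<bar>integral {1..b} ?h - integral {1..Z k} ?h\<bar> < e / 2" if "Z k \<le> b" for b
    proof -
      have "integral {1..b} ?h = integral {1..Z k} ?h + integral {Z k..b} ?h"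
        using Zk that
        by (intro Henstock_Kurzweil_Integration.integral_combine[symmetric] weighted_integrable f(1)) auto
      then show ?thesis using tail_bound[OF f _ that] k by simp
    qed
    then have "dist (integral {1..b} ?h) (integral {1..b'} ?h) < e" if "Z k \<le> b" "Z k \<le> b'" for b b'
      using dist_triangle_half_l[of "integral {1..b} ?h" "integral {1..Z k} ?h" e] that
      by (simp add: dist_real_def)
    then show "\<exists>P. eventually P at_top \<and>
        (\<forall>b b'. P b \<longrightarrow> P b' \<longrightarrow> dist (integral {1..b} ?h) (integral {1..b'} ?h) < e)"
      using eventually_ge_at_top[of "Z k"] by blast
  qed simp
  then obtain J where J: "((\<lambda>b. integral {1..b} ?h) \<longlongrightarrow> J) at_top" by blast
  have "((\<lambda>p. integral {fst p..1} ?h + integral {1..snd p} ?h) \<longlongrightarrow> I + J) (at_right 0 \<times>\<^sub>F at_top)"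
    by (intro tendsto_add filterlim_compose[OF at_0 filterlim_fst] filterlim_compose[OF J filterlim_snd])
  moreover have "\<forall>\<^sub>F p in at_right 0 \<times>\<^sub>F at_top.
      integral {fst p..1} ?h + integral {1..snd p} ?h = integral {fst p..snd p} ?h"
    unfolding eventually_prod_filter
  proof (intro exI conjI allI impI)
    show "\<forall>\<^sub>F a in at_right (0::real). 0 < a \<and> a < 1"
      using eventually_at_right_real[of 0 "1::real"] by simp
    show "\<forall>\<^sub>F b in at_top. (1::real) \<le> b" by (rule eventually_ge_at_top)
    fix a b :: real assume "0 < a \<and> a < 1" "1 \<le> b"
    then show "integral {fst (a, b)..1} ?h + integral {1..snd (a, b)} ?h = integral {fst (a, b)..snd (a, b)} ?h"
      unfolding fst_conv snd_conv
      by (intro Henstock_Kurzweil_Integration.integral_combine weighted_integrable f(1)) auto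
  qed
  ultimately have "((\<lambda>p. integral {fst p..snd p} ?h) \<longlongrightarrow> I + J) (at_right 0 \<times>\<^sub>F at_top)"
    by (rule Lim_transform_eventually)
  then show ?thesis
    unfolding has_improper_integral_def case_prod_beta using weighted_integrable[OF f(1)] by blast
qed

lemma improper_integral_positive:
  assumes f: "antimono_on {0<..} f" "\<And>t. 0 < t \<Longrightarrow> 0 \<le> f t"
    and p: "0 < p" "p < Z 1" "f p < f (p / 2)"
    and I: "has_improper_integral (\<lambda>t. f t * u t) I"
  shows "0 < I"
proof -
  \<comment> \<open>The value \<open>f p\<close> at \<open>0\<close> makes \<open>G\<close>
    decreasing on the closed half-line, whatever \<open>f 0\<close> may be, so integrals of
    \<open>G t * u t\<close> can start at the zero \<open>0\<close>.\<close>
  define G where "G = (\<lambda>t. if 0 < t then min (f t) (f p) else f p)"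
  \<comment> \<open>Lower bound for the contribution of \<open>f - G\<close>: on this interval
    \<open>f\<close> is at least \<open>f (p / 2)\<close>, while \<open>G\<close> equals
    \<open>f p\<close>. The left end \<open>p / 4\<close> keeps away from \<open>0\<close>.\<close>
  define c where "c = integral {p/4..p/2} (\<lambda>t. (f (p / 2) - f p) * u t)"
  have f_le: "f t \<le> f s" if "0 < s" "s \<le> t" for s t
    using f(1) that by (auto simp: monotone_on_def)
  have G_anti: "antimono_on {0..} G"
    using f_le f(2) p by (auto simp: monotone_on_def G_def min_def) (meson order_trans linear less_le_trans)+
  have G_int: "(\<lambda>t. G t * u t) integrable_on {a..b}" if "0 \<le> a" for a b
    using that by (intro integrable_antimono_mult u_integrable monotone_on_subset[OF G_anti]) auto
  have u_nonneg: "0 \<le> u t" if "0 \<le> t" "t \<le> p" for t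
    using u_pos[of t] that p u_Z[of 0] Z_0 by (cases "t = 0") auto
  have "0 < c"
  proof -
    obtain z where z: "z \<in> {p/4..p/2}" "\<And>t. t \<in> {p/4..p/2} \<Longrightarrow> u z \<le> u t"
      using continuous_attains_inf[of "{p/4..p/2}" u] p continuous_on_subset[OF u_cont, of "{p/4..p/2}"]
      by auto
    have "0 < (f (p / 2) - f p) * u z * (p / 4)"
      using z(1) p by (intro mult_pos_pos u_pos) auto
    also have "\<dots> = integral {p/4..p/2} (\<lambda>t. (f (p / 2) - f p) * u z)"
      using p by simp
    also have "\<dots> \<le> c"
      unfolding c_def using z p
      by (intro integral_le integrable_on_mult_right u_integrable) (auto intro: mult_left_mono)
    finally show ?thesis .
  qed
  \<comment> \<open>The integral of \<open>f\<close> starts at \<open>a\<close>, but the sign result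
    for \<open>G\<close> starts at \<open>0\<close>; the subtracted term corrects for this and
    vanishes as \<open>a\<close> tends to \<open>0\<close>.\<close>
  have lower: "c - integral {0..a} (\<lambda>t. G t * u t) \<le> integral {a..b} (\<lambda>t. f t * u t)"
    if a: "0 < a" "a \<le> p / 4" and b: "p \<le> b" for a b
  proof -
    have "c \<le> integral {p/4..p/2} (\<lambda>t. f t * u t - G t * u t)"
      unfolding c_def
    proof (rule integral_le)
      fix t assume t: "t \<in> {p/4..p/2}"
      then have "f (p / 2) \<le> f t" "f p \<le> f t" using p by (auto intro!: f_le)
      moreover have "0 \<le> u t" using t p by (intro u_nonneg) auto
      ultimately show "(f (p / 2) - f p) * u t \<le> f t * u t - G t * u t"
        using t p by (simp add: G_def min_def mult_right_mono flip: left_diff_distrib)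
    qed (use p in \<open>auto intro!: integrable_diff weighted_integrable f(1) G_int integrable_on_mult_right u_integrable\<close>)
    also have "\<dots> \<le> integral {a..b} (\<lambda>t. f t * u t - G t * u t)"
    proof (rule integral_subset_le)
      show "\<forall>t\<in>{a..b}. 0 \<le> f t * u t - G t * u t"
      proof
        fix t assume t: "t \<in> {a..b}"
        then have "0 < t" using a by simp
        show "0 \<le> f t * u t - G t * u t"
        proof (cases "t \<le> p")
          case True
          then have "0 \<le> (f t - G t) * u t"
            using u_nonneg[of t] \<open>0 < t\<close> by (intro mult_nonneg_nonneg) (auto simp: G_def)
          then show ?thesis by (simp add: left_diff_distrib)
        next
          case False
          then have "f t \<le> f p" using p by (intro f_le) auto
          then show ?thesis using \<open>0 < t\<close> by (simp add: G_def)
        qed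
      qed
    qed (use a b p in \<open>auto intro!: integrable_diff weighted_integrable f(1) G_int\<close>)
    also have "\<dots> = integral {a..b} (\<lambda>t. f t * u t) - integral {a..b} (\<lambda>t. G t * u t)"
      using a by (intro Henstock_Kurzweil_Integration.integral_diff weighted_integrable f(1) G_int) auto
    also have "integral {a..b} (\<lambda>t. G t * u t) =
        integral {0..b} (\<lambda>t. G t * u t) - integral {0..a} (\<lambda>t. G t * u t)"
      using Henstock_Kurzweil_Integration.integral_combine[of 0 a b "\<lambda>t. G t * u t"] a b p G_int by auto
    finally have "c \<le> integral {a..b} (\<lambda>t. f t * u t) -
      (integral {0..b} (\<lambda>t. G t * u t) - integral {0..a} (\<lambda>t. G t * u t))" .
    moreover have "0 \<le> integral {0..b} (\<lambda>t. G t * u t)"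
      using sign_weighted_integral_nonneg[of 0 b G] b p f(2)[of p] f(2)[of b]
        monotone_on_subset[OF G_anti, of "{0..b}"] by (auto simp: Z_0 G_def)
    ultimately show ?thesis by simp
  qed
  have "continuous_on {0..p} (\<lambda>a. integral {0..a} (\<lambda>t. G t * u t))"
    by (intro indefinite_integral_continuous_1 G_int) simp
  then have "((\<lambda>a. integral {0..a} (\<lambda>t. G t * u t)) \<longlongrightarrow> 0) (at_right 0)"
    using p by (auto simp: continuous_on_Icc_at_rightD dest: continuous_on_Icc_at_rightD)
  then have "((\<lambda>x. c - integral {0..fst x} (\<lambda>t. G t * u t)) \<longlongrightarrow> c - 0) (at_right 0 \<times>\<^sub>F at_top)"
    by (intro tendsto_diff tendsto_const filterlim_compose[OF _ filterlim_fst])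
  moreover have "((\<lambda>x. integral {fst x..snd x} (\<lambda>t. f t * u t)) \<longlongrightarrow> I) (at_right 0 \<times>\<^sub>F at_top)"
    using I unfolding has_improper_integral_def case_prod_beta by blast
  moreover have "\<forall>\<^sub>F x in at_right 0 \<times>\<^sub>F at_top.
      c - integral {0..fst x} (\<lambda>t. G t * u t) \<le> integral {fst x..snd x} (\<lambda>t. f t * u t)"
    unfolding eventually_prod_filter
  proof (intro exI conjI allI impI)
    show "\<forall>\<^sub>F a in at_right (0::real). 0 < a \<and> a < p / 4"
      using eventually_at_right_real[of 0 "p / 4"] p by simp
    show "\<forall>\<^sub>F b in at_top. p \<le> b" by (rule eventually_ge_at_top)
  qed (use lower in auto)
  ultimately have "c - 0 \<le> I"
    by (intro tendsto_le[of "at_right (0::real) \<times>\<^sub>F (at_top :: real filter)"])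
      (simp_all add: prod_filter_eq_bot)
  with \<open>0 < c\<close> show ?thesis by simp
qed

text \<open>Near \<open>0\<close>, \<open>u\<close> is convex if \<open>\<phi>\<close> is nonpositive somewhere, and concave otherwise.\<close>

lemma mono_near_0: "\<exists>\<delta>>0. mono_on {0<..\<delta>} u"
proof -
  define z where "z = Z 1"
  have z: "0 < z" using Z_Suc_pos[of 0] by (simp add: z_def)
  have cont: "continuous_on {a..b} u" if "0 \<le> a" for a b
    using that by (intro continuous_on_subset[OF u_cont]) auto
  have u0: "u 0 = 0" using u_Z[of 0] by (simp only: Z_0)
  have mvt: "\<exists>r. s < r \<and> r < t \<and> u t - u s = (t - s) * u' r" if "0 \<le> s" "s < t" for s t
    using MVT[of s t u] that cont u_deriv
    by (smt (verit) DERIV_unique real_differentiable_def)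
  have mono: "mono_on {0<..\<delta>} u" if "\<And>t. 0 < t \<Longrightarrow> t \<le> \<delta> \<Longrightarrow> 0 \<le> u' t" for \<delta>
  proof (rule mono_onI)
    fix r s assume rs: "r \<in> {0<..\<delta>}" "s \<in> {0<..\<delta>}" "r \<le> s"
    show "u r \<le> u s"
    proof (rule DERIV_nonneg_imp_nondecreasing[of r s u])
      fix x assume "r \<le> x" "x \<le> s"
      then show "\<exists>y. (u has_real_derivative y) (at x) \<and> 0 \<le> y"
        using rs u_deriv[of x] that[of x] by auto
    qed (use rs in simp)
  qed
  show ?thesis
  proof (cases "\<exists>\<delta>>0. \<phi> \<delta> \<le> 0")
    case True
    then obtain d where d: "d > 0" "\<phi> d \<le> 0" by blast
    define \<delta> where "\<delta> = min d (z / 2)"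
    have \<delta>: "0 < \<delta>" "\<delta> \<le> d" "\<delta> < z" using d z by (auto simp: \<delta>_def min_def)
    have u'_mono: "u' s \<le> u' t" if "0 < s" "s \<le> t" "t \<le> \<delta>" for s t
    proof (rule DERIV_nonneg_imp_nondecreasing[of s t u'])
      fix x assume "s \<le> x" "x \<le> t"
      then have x: "0 < x" "x \<le> \<delta>" using that by auto
      have "\<phi> x \<le> \<phi> d" using phi_mono x \<delta> by (auto simp: monotone_on_def)
      then have "0 \<le> - (\<phi> x * u x)"
        using d u_pos[of x] x \<delta> by (simp add: z_def mult_nonpos_nonneg)
      then show "\<exists>y. (u' has_real_derivative y) (at x) \<and> 0 \<le> y" using u'_deriv[OF x(1)] by blast
    qed (use that in simp)
    \<comment> \<open>Since \<open>u\<close> rises from \<open>0\<close>, some slope before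
      \<open>t\<close> is positive, and convexity carries this forward to \<open>t\<close>.\<close>
    have "0 \<le> u' t" if t: "0 < t" "t \<le> \<delta>" for t
    proof -
      obtain r where r: "0 < r" "r < t" "u t - u 0 = (t - 0) * u' r" using mvt[of 0 t] t by auto
      then have "0 < t * u' r" using u0 u_pos[of t] t \<delta> by (simp add: z_def)
      then have "0 < u' r" using t by (simp add: zero_less_mult_iff)
      then show ?thesis using u'_mono[of r t] r t by simp
    qed
    then show ?thesis using mono \<delta>(1) by blast
  next
    case False
    then have phi_pos: "0 < \<phi> t" if "0 < t" for t using that by (simp add: not_le)
    \<comment> \<open>The mean slope over \<open>[0, z / 2]\<close> is positive and attained at
      \<open>r\<close>; by concavity all earlier slopes are at least as large.\<close>
    obtain r where r: "0 < r" "r < z / 2" "u (z / 2) - u 0 = (z / 2 - 0) * u' r"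
      using mvt[of 0 "z / 2"] z by auto
    then have "0 < z / 2 * u' r" using u0 u_pos[of "z / 2"] z by (simp add: z_def)
    then have "0 < u' r" using z by (simp add: zero_less_mult_iff)
    have "u' r \<le> u' t" if t: "0 < t" "t \<le> r" for t
    proof (rule DERIV_nonpos_imp_nonincreasing[of t r u'])
      fix x assume "t \<le> x" "x \<le> r"
      then have x: "0 < x" "x < z" using t r z by auto
      have "- (\<phi> x * u x) \<le> 0" using phi_pos[of x] u_pos[of x] x by (simp add: z_def)
      then show "\<exists>y. (u' has_real_derivative y) (at x) \<and> y \<le> 0" using u'_deriv[OF x(1)] by blast
    qed (use t in simp)
    with \<open>0 < u' r\<close> have "0 \<le> u' t" if "0 < t" "t \<le> r" for t using that by fastforce
    then show ?thesis using mono r(1) by blast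
  qed
qed

section \<open>Change of scale\<close>

text \<open>By the chain rule the coefficient becomes \<open>x\<^sup>2 * \<phi> (x * t)\<close>,
  still increasing. Thus the transform at \<open>x\<close> is the plain integral of \<open>f\<close>
  against another solution of the same kind.\<close>

lemma scale:
  assumes "0 < x"
  shows "oscillating_solution (\<lambda>t. x\<^sup>2 * \<phi> (x * t)) (\<lambda>t. u (x * t)) (\<lambda>t. x * u' (x * t)) (\<lambda>k. Z k / x)"
proof
  show "mono_on {0<..} (\<lambda>t. x\<^sup>2 * \<phi> (x * t))"
    using phi_mono assms by (auto simp: monotone_on_def)
  show "continuous_on {0..} (\<lambda>t. u (x * t))"
    using assms by (intro continuous_on_compose2[OF u_cont] continuous_intros) auto
  have lin: "((\<lambda>t. x * t) has_real_derivative x) (at t)" for t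
    by (auto intro!: derivative_eq_intros)
  show "((\<lambda>t. u (x * t)) has_real_derivative x * u' (x * t)) (at t)" if "0 < t" for t
    using u_chain[OF lin] that assms by (simp add: mult.commute)
  show "((\<lambda>t. x * u' (x * t)) has_real_derivative - (x\<^sup>2 * \<phi> (x * t) * u (x * t))) (at t)"
    if "0 < t" for t
    using DERIV_cmult[OF u'_chain[OF lin], of t x] that assms by (simp add: power2_eq_square ac_simps)
  show "strict_mono (\<lambda>k. Z k / x)"
    using Z_mono assms by (simp add: strict_mono_def divide_strict_right_mono)
  show "u (x * t) = 0 \<longleftrightarrow> t \<in> range (\<lambda>k. Z k / x)" if "0 \<le> t" for t
    using zeros[of "x * t"] that assms by (auto simp: image_iff field_simps)
  show "0 < u (x * t)" if "0 < t" "t < Z 1 / x" for t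
    using u_pos[of "x * t"] that assms by (simp add: field_simps)
qed (simp add: Z_0)

end

section \<open>Improper integrals: domination, null sets, uniqueness\<close>

text \<open>The difference of two values is an integral over \<open>[x, y]\<close> near
  \<open>0\<close>, where that of \<open>g\<close> lies between \<open>0\<close> and that of
  \<open>h\<close>. So the Cauchy property passes from \<open>h\<close> to \<open>g\<close>.\<close>

lemma tendsto_integral_dominated_at_0:
  fixes g h :: "real \<Rightarrow> real"
  assumes int: "\<And>a b. 0 < a \<Longrightarrow> g integrable_on {a..b}" "\<And>a b. 0 < a \<Longrightarrow> h integrable_on {a..b}"
    and bound: "0 < \<delta>" "\<And>t. 0 < t \<Longrightarrow> t < \<delta> \<Longrightarrow> 0 \<le> g t \<and> g t \<le> h t"
    and h: "((\<lambda>\<epsilon>. integral {\<epsilon>..1} h) \<longlongrightarrow> I) (at_right 0)"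
  shows "\<exists>J. ((\<lambda>\<epsilon>. integral {\<epsilon>..1} g) \<longlongrightarrow> J) (at_right 0)"
proof (rule tendsto_if_cauchy)
  fix e :: real assume "e > 0"
  with cauchy_if_tendsto[OF h] obtain P where P: "eventually P (at_right 0)"
    "\<And>x y. P x \<Longrightarrow> P y \<Longrightarrow> dist (integral {x..1} h) (integral {y..1} h) < e" by meson
  define Q where "Q = (\<lambda>x. P x \<and> x \<in> {0<..<min \<delta> 1})"
  have "eventually Q (at_right 0)"
    unfolding Q_def using bound(1) P(1) by (intro eventually_conj eventually_at_right_real) auto
  moreover have "dist (integral {x..1} g) (integral {y..1} g) < e" if "Q x" "Q y" for x y
    using that
  proof (induction x y rule: linorder_wlog)
    case (le x y)
    then have xy: "0 < x" "x \<le> y" "y < \<delta>" "y < 1" "P x" "P y" by (auto simp: Q_def)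
    have split: "integral {x..1} k = integral {x..y} k + integral {y..1} k"
      if "\<And>a b. 0 < a \<Longrightarrow> k integrable_on {a..b}" for k :: "real \<Rightarrow> real"
      using Henstock_Kurzweil_Integration.integral_combine[of x y 1 k] xy that by simp
    have "0 \<le> integral {x..y} g"
      using xy bound(2) by (intro Henstock_Kurzweil_Integration.integral_nonneg int) auto
    moreover have "integral {x..y} g \<le> integral {x..y} h"
      using xy bound(2) by (intro integral_le int) auto
    ultimately show ?case
      using P(2)[OF xy(5,6)] split[of g] split[of h] int by (simp add: dist_real_def)
  qed (simp add: dist_commute)
  ultimately show "\<exists>P. eventually P (at_right 0) \<and>
      (\<forall>x y. P x \<longrightarrow> P y \<longrightarrow> dist (integral {x..1} g) (integral {y..1} g) < e)" by blast
qed simp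

lemma has_improper_integral_spike:
  assumes "negligible N" "\<And>t. t \<notin> N \<Longrightarrow> g t = h t"
  shows "has_improper_integral g I \<longleftrightarrow> has_improper_integral h I"
proof -
  have "integral {a..b} g = integral {a..b} h" "g integrable_on {a..b} \<longleftrightarrow> h integrable_on {a..b}" for a b
    using assms by (auto intro!: integral_spike intro: integrable_spike[OF _ assms(1)])
  then show ?thesis by (simp add: has_improper_integral_def)
qed

lemma has_improper_integral_unique:
  assumes "has_improper_integral g I" "has_improper_integral g J"
  shows "I = J"
  using assms tendsto_unique[of "at_right (0::real) \<times>\<^sub>F (at_top :: real filter)"]
  unfolding has_improper_integral_def by (auto simp: prod_filter_eq_bot)

lemma improper_integral_eq:
  "has_improper_integral g I \<Longrightarrow> improper_integral g = I"
  unfolding improper_integral_def by (blast intro: has_improper_integral_unique)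

text \<open>Near \<open>0\<close>, P1 controls \<open>f t * u (x * t)\<close> by comparison when
  \<open>x \<le> 1\<close>. For \<open>x > 1\<close> the quotient of \<open>u (x * t)\<close> by
  \<open>u t\<close> can be unbounded, as for a solution equal to \<open>exp (- 1 / t)\<close> near
  \<open>0\<close>; hence convergence at \<open>0\<close> is assumed there. The support has to reach
  down to \<open>0\<close>: a weight living between the first two zeros would make the transform at
  \<open>1\<close> negative.\<close>

theorem theorem3p2:
  fixes \<phi> u f :: "real \<Rightarrow> real" and \<zeta> :: "nat \<Rightarrow> real"
  assumes phi_cont: "continuous_on {0<..} \<phi>"
    and phi_incr: "mono_on {0<..} \<phi>"
    and phi_cond: "cond_A1 \<phi> \<or> cond_A2 \<phi> \<or> cond_A3 \<phi>"
    and u_sol: "solves_on_pos \<phi> u"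
    and u_osc: "oscillatory_on {0<..} u"
    and zeros_incr: "strict_mono_on {1..} \<zeta>"
    and zeros_all: "\<zeta> ` {1..} = {t. 0 < t \<and> u t = 0}"
    and u_0: "(u \<longlongrightarrow> 0) (at_right 0)"
    and u_pos: "\<And>t. 0 < t \<Longrightarrow> t < \<zeta> 1 \<Longrightarrow> u t > 0"
    and f_nonneg: "\<And>t. t > 0 \<Longrightarrow> f t \<ge> 0"
    and f_sect_cont: "sectionally_continuous_on_pos f"
    and f_strict_decr: "strict_antimono_on (support_pos f) f"
    and f_supp_nonempty: "support_pos f \<noteq> {}"
    and f_supp_initial: "\<And>s t. t \<in> support_pos f \<Longrightarrow> 0 < s \<Longrightarrow> s < t \<Longrightarrow> s \<in> support_pos f"
    and P1: "improper_at_0_converges (\<lambda>t. f t * u t)"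
    and P2: "\<And>x. x > 0 \<Longrightarrow>
               (\<lambda>k. integral {\<zeta> k..\<zeta> (Suc k)} (\<lambda>t. f (t / x) * \<bar>u t\<bar>)) \<longlonglongrightarrow> 0"
  shows "\<forall>x>0. (x > 1 \<longrightarrow> improper_at_0_converges (\<lambda>t. f t * u (x * t))) \<longrightarrow>
               U_exists u f x \<and> U_transform u f x > 0"
proof (intro allI impI)
  fix x :: real
  assume x: "0 < x" and conv_at_0: "1 < x \<longrightarrow> improper_at_0_converges (\<lambda>t. f t * u (x * t))"
  \<comment> \<open>The limit \<open>u(0+) = 0\<close> says nothing about \<open>u 0\<close>;
    resetting that value gives continuity at \<open>0\<close> and changes no integral.\<close>
  define v where "v = u(0 := 0)"
  \<comment> \<open>Only the indices from \<open>1\<close> on are meaningful for \<zeta>, so the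
    arbitrary \<open>\<zeta> 0\<close> is replaced by the zero at the left end.\<close>
  define Z where "Z k = (if k = 0 then 0 else \<zeta> k)" for k
  obtain u' where u': "\<And>t. 0 < t \<Longrightarrow> (u has_real_derivative u' t) (at t)"
    "\<And>t. 0 < t \<Longrightarrow> (u' has_real_derivative - (\<phi> t * u t)) (at t)"
    using u_sol unfolding solves_on_pos_def by blast
  have \<zeta>_pos: "0 < \<zeta> k" if "1 \<le> k" for k using zeros_all that by auto
  have v_deriv: "(v has_real_derivative u' t) (at t)" if "0 < t" for t
    by (rule has_field_derivative_transform_within_open[OF u'(1)[OF that], where S="{0<..}"])
      (use that in \<open>auto simp: v_def\<close>)
  interpret v: oscillating_solution \<phi> v u' Z
  proof
    show "continuous_on {0..} v"
      unfolding continuous_on_def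
    proof
      fix t :: real assume "t \<in> {0..}"
      then consider "t = 0" | "0 < t" by fastforce
      then show "(v \<longlongrightarrow> v t) (at t within {0..})"
      proof cases
        case 1
        have "(v \<longlongrightarrow> 0) (at_right 0)"
          by (rule Lim_transform_eventually[OF u_0])
            (use eventually_at_right_less[of "0::real"] in \<open>eventually_elim, simp add: v_def\<close>)
        then show ?thesis using 1 by (simp add: v_def at_within_Ici_at_right)
      next
        case 2
        then show ?thesis
          using DERIV_isCont[OF v_deriv[OF 2]] by (auto simp: isCont_def intro: tendsto_within_subset)
      qed
    qed
    show "(u' has_real_derivative - (\<phi> t * v t)) (at t)" if "0 < t" for t
      using u'(2)[OF that] that by (simp add: v_def)
    show "strict_mono Z"
      using zeros_incr \<zeta>_pos by (auto simp: strict_mono_def Z_def monotone_on_def)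
    have "range Z = Z ` insert 0 {1..}" by (rule arg_cong[where f="image Z"]) auto
    also have "\<dots> = insert 0 (\<zeta> ` {1..})" by (auto simp: Z_def)
    finally show "v t = 0 \<longleftrightarrow> t \<in> range Z" if "0 \<le> t" for t
      using that zeros_all by (auto simp: v_def)
    show "0 < v t" if "0 < t" "t < Z 1" for t
      using u_pos that by (simp add: v_def Z_def)
  qed (fact phi_incr v_deriv | simp add: Z_def)+
  interpret s: oscillating_solution "\<lambda>t. x\<^sup>2 * \<phi> (x * t)" "\<lambda>t. v (x * t)" "\<lambda>t. x * u' (x * t)" "\<lambda>k. Z k / x"
    by (rule v.scale[OF x])
  \<comment> \<open>Strict decrease on an initial interval, followed by the value \<open>0\<close>,
    is weak decrease on the whole half-line.\<close>
  have f_anti: "antimono_on {0<..} f"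
  proof (rule monotone_onI)
    fix s t :: real assume st: "s \<in> {0<..}" "t \<in> {0<..}" "s \<le> t"
    show "f t \<le> f s"
    proof (cases "s = t \<or> f t = 0")
      case False
      then have "t \<in> support_pos f" "s < t" using st by (auto simp: support_pos_def)
      then show ?thesis
        using f_supp_initial[of t s] f_strict_decr st by (auto simp: monotone_on_def less_imp_le)
    qed (use st f_nonneg in auto)
  qed
  have at_0: "\<exists>I. ((\<lambda>\<epsilon>. integral {\<epsilon>..1} (\<lambda>t. f t * v (x * t))) \<longlongrightarrow> I) (at_right 0)"
  proof (cases "1 < x")
    case True
    have "integral {a..b} (\<lambda>t. f t * v (x * t)) = integral {a..b} (\<lambda>t. f t * u (x * t))" for a b
      by (rule integral_spike[of "{0}"]) (use x in \<open>auto simp: v_def\<close>)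
    then show ?thesis using conv_at_0 True by (simp add: improper_at_0_converges_def)
  next
    case False
    have "integral {a..b} (\<lambda>t. f t * v t) = integral {a..b} (\<lambda>t. f t * u t)" for a b
      by (rule integral_spike[of "{0}"]) (auto simp: v_def)
    then obtain I where I: "((\<lambda>\<epsilon>. integral {\<epsilon>..1} (\<lambda>t. f t * v t)) \<longlongrightarrow> I) (at_right 0)"
      using P1 by (auto simp: improper_at_0_converges_def)
    \<comment> \<open>For \<open>x \<le> 1\<close>, monotonicity near \<open>0\<close> gives
      \<open>v (x * t) \<le> v t\<close>, so P1 provides the dominating integral.\<close>
    obtain \<delta> where \<delta>: "0 < \<delta>" "mono_on {0<..\<delta>} v" using v.mono_near_0 by blast
    show ?thesis
    proof (rule tendsto_integral_dominated_at_0[where \<delta>="min \<delta> (Z 1)", OF _ _ _ _ I])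
      fix t assume t: "0 < t" "t < min \<delta> (Z 1)"
      have xt: "0 < x * t" "x * t \<le> t" using False x t by (simp_all add: mult_left_le_one_le)
      then have "x * t \<le> \<delta>" "x * t < Z 1" using t by linarith+
      then have "v (x * t) \<le> v t" "0 \<le> v (x * t)"
        using monotone_onD[OF \<delta>(2), of "x * t" t] t xt v.u_pos[of "x * t"] by auto
      then show "0 \<le> f t * v (x * t) \<and> f t * v (x * t) \<le> f t * v t"
        using f_nonneg[OF t(1)] by (simp add: mult_left_mono)
    qed (use \<delta> v.Z_Suc_pos[of 0] f_anti in \<open>auto intro: v.weighted_integrable s.weighted_integrable\<close>)
  qed
  have areas: "(\<lambda>k. integral {Z k / x..Z (Suc k) / x} (\<lambda>t. f t * \<bar>v (x * t)\<bar>)) \<longlonglongrightarrow> 0"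
  proof -
    \<comment> \<open>Substituting \<open>t / x\<close> for \<open>t\<close> turns P2 into the areas
      of the scaled solution, up to the factor \<open>1 / x\<close>. Index \<open>0\<close> is left
      out because \<open>\<zeta> 0\<close> is arbitrary.\<close>
    have "integral {Z k / x..Z (Suc k) / x} (\<lambda>t. f t * \<bar>v (x * t)\<bar>) =
        1 / x * integral {\<zeta> k..\<zeta> (Suc k)} (\<lambda>t. f (t / x) * \<bar>u t\<bar>)" if k: "1 \<le> k" for k
    proof -
      have img: "(\<lambda>t. t / x) ` {a..b} = {a / x..b / x}" for a b
        using x by (auto simp: image_iff field_simps intro!: bexI[of _ "_ * x"])
      have "integral {\<zeta> k..\<zeta> (Suc k)} (\<lambda>t. f (t / x) * \<bar>u t\<bar>) =
          integral {Z k..Z (Suc k)} (\<lambda>t. f (t / x) * \<bar>v t\<bar>)"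
        using k \<zeta>_pos[OF k] by (auto simp: Z_def v_def intro!: Henstock_Kurzweil_Integration.integral_cong)
      then show ?thesis
        using integral_stretch_real[of x "Z k" "Z (Suc k)" "\<lambda>t. f (t / x) * \<bar>v t\<bar>"] x by (simp add: img)
    qed
    then have "\<forall>\<^sub>F k in sequentially. 1 / x * integral {\<zeta> k..\<zeta> (Suc k)} (\<lambda>t. f (t / x) * \<bar>u t\<bar>) =
        integral {Z k / x..Z (Suc k) / x} (\<lambda>t. f t * \<bar>v (x * t)\<bar>)"
      by (intro eventually_sequentiallyI[of 1]) simp
    then show ?thesis
      using Lim_transform_eventually[OF tendsto_mult_right_zero[OF P2[OF x], of "1 / x"]] by simp
  qed
  obtain I where I: "has_improper_integral (\<lambda>t. f t * v (x * t)) I"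
    using s.has_improper_integral_exists[OF f_anti f_nonneg _ areas] at_0 by blast
  obtain q where q: "q \<in> support_pos f" using f_supp_nonempty by blast
  \<comment> \<open>The minimum with \<open>q\<close> keeps \<open>p\<close> and
    \<open>p / 2\<close> in the support, where the decrease is strict; the halving puts
    \<open>p\<close> strictly before the first scaled zero \<open>Z 1 / x\<close>.\<close>
  define p where "p = min q (Z 1 / (2 * x))"
  have p: "0 < p" "p \<le> q" "p < Z 1 / x"
    using q x v.Z_Suc_pos[of 0] by (auto simp: p_def support_pos_def min_def field_simps)
  then have "p \<in> support_pos f" using f_supp_initial[OF q, of p] q by (cases "p = q") auto
  then have "f p < f (p / 2)"
    using f_supp_initial[of p "p / 2"] p(1) f_strict_decr by (auto simp: monotone_on_def)
  then have "0 < I"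
    using s.improper_integral_positive[OF f_anti f_nonneg p(1,3) _ I] by blast
  moreover have "has_improper_integral (\<lambda>t. f t * u (x * t)) I"
    using I by (subst has_improper_integral_spike[where N="{0}" and h="\<lambda>t. f t * v (x * t)"])
      (use x in \<open>auto simp: v_def\<close>)
  ultimately show "U_exists u f x \<and> U_transform u f x > 0"
    by (auto simp: U_exists_def U_transform_def improper_integral_eq)
qed

end
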